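(* Let $(\Omega,\mathscr{H},\widehat{\mathbb E})$ be a sub-linear expectation space over a measurable space $(\Omega,\mathcal F)$, with upper capacity $\mathbb V$. Let $\{X_n;n\ge 1\}$ be a sequence of independent random variables in $(\Omega,\mathscr{H},\widehat{\mathbb E})$, $S_n=\sum_{k=1}^n X_k$, and let $S$ be a random variable on the measurable space $(\Omega,\mathcal F)$. Consider the two statements (A) $\mathbb V(|S_n-S|\ge \epsilon)\to 0$ as $n\to\infty$, for all $\epsilon>0$; (B) $\mathbb V\big(\{\omega: \lim_{n\to\infty}S_n(\omega)\ne S(\omega)\}\big)=0$. Then: (i) If $\mathbb V$ is countably sub-additive and (A) holds, then (B) holds. (ii) If $\mathbb V$ is continuous, then (B) implies (A).
   Context: Framework. $(\Omega,\mathcal F)$ is a measurable space and $\mathscr{H}$ is a linear space of real ($\mathcal F$-measurable) functions on $\Omega$ such that $X_1,\dots,X_n\in\mathscr{H}$ implies $\varphi(X_1,\dots,X_n)\in\mathscr{H}$ for every $\varphi\in C_{l,Lip}(\mathbb R^n)$, where $C_{l,Lip}(\mathbb R^n)$ is the space of functions $\varphi$ with $|\varphi(x)-\varphi(y)|\le C(1+|x|^m+|y|^m)|x-y|$ for all $x,y\in\mathbb R^n$, for some $C>0$, $m\in\mathbb N$ depending on $\varphi$. Elements of $\mathscr{H}$ are the random variables in the space. A sub-linear expectation on $\mathscr{H}$ is a function $\widehat{\mathbb E}:\mathscr{H}\to[-\infty,\infty]$ such that for all $X,Y\in\mathscr{H}$: (a) $X\ge Y$ implies $\widehat{\mathbb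 E}[X]\ge\widehat{\mathbb E}[Y]$; (b) $\widehat{\mathbb E}[c]=c$ for constants $c$; (c) $\widehat{\mathbb E}[X+Y]\le\widehat{\mathbb E}[X]+\widehat{\mathbb E}[Y]$ whenever the right side is not of the form $+\infty-\infty$ or $-\infty+\infty$; (d) $\widehat{\mathbb E}[\lambda X]=\lambda\widehat{\mathbb E}[X]$ for $\lambda\ge 0$. The triple $(\Omega,\mathscr{H},\widehat{\mathbb E})$ is called a sub-linear expectation space. Capacity. $\mathbb V(A):=\inf\{\widehat{\mathbb E}[\xi]: I_A\le\xi,\ \xi\in\mathscr{H}\}$ for $A\in\mathcal F$. $\mathbb V$ is countably sub-additive if $\mathbb V(\bigcup_{n=1}^\infty A_n)\le\sum_{n=1}^\infty\mathbb V(A_n)$ for all $A_n\in\mathcal F$. $\mathbb V$ is continuous if $\mathbb V(A_n)\uparrow\mathbb V(A)$ whenever $A_n\uparrow A$, and $\mathbb V(A_n)\downarrow\mathbb V(A)$ whenever $A_n\downarrow A$ ($A_n,A\in\mathcal F$). Independence. Let $C_{b,Lip}$ denote bounded Lipschitz functions. A random vector $Y=(Y_1,\dots,Y_n)$ ($Y_i\in\mathscr{H}$) is independent to $X=(X_1,\dots,X_m)$ ($X_i\in\mathscr{H}$) if $\widehat{\mathbb E}[\varphi(X,Y)]=\widehat{\mathbb E}\big[\widehat{\mathbb E}[\varphi(x,Y)]|_{x=X}\big]$ for all $\varphi\in C_{b,Lip}(\mathbb R^m\times\mathbb R^n)$. Random variables $\{X_n;n\ge1\}$ are independent if $X_{i+1}$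 is independent to $(X_1,\dots,X_i)$ for each $i\ge1$. A random variable on the measurable space $(\Omega,\mathcal F)$ is a real $\mathcal F$-measurable function, not necessarily in $\mathscr{H}$. The event $\{\lim_n S_n\neq S\}$ is the complement of the event that $S_n(\omega)$ converges to $S(\omega)$. *)

theory Defs
  imports "HOL-Analysis.Analysis"
begin

text \<open>
  A point of \<open>n\<close>-dimensional Euclidean space is given by the coordinates \<open>0, ..., n - 1\<close> of a
  function \<open>x :: nat \<Rightarrow> real\<close>, with norm \<open>L2_set x {..<n}\<close>. Each of the two Lipschitz conditions
  below forces \<open>\<phi>\<close> to depend on these coordinates only.
\<close>

definition C_l_Lip :: "nat \<Rightarrow> ((nat \<Rightarrow> real) \<Rightarrow> real) set" where
  "C_l_Lip n = {\<phi>. \<exists>C>0. \<exists>m::nat. \<forall>x y.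
     \<bar>\<phi> x - \<phi> y\<bar> \<le> C * (1 + L2_set x {..<n} ^ m + L2_set y {..<n} ^ m)
                     * L2_set (\<lambda>i. x i - y i) {..<n}}"

definition C_b_Lip :: "nat \<Rightarrow> ((nat \<Rightarrow> real) \<Rightarrow> real) set" where
  "C_b_Lip n = {\<phi>. (\<exists>K. \<forall>x. \<bar>\<phi> x\<bar> \<le> K) \<and>
     (\<exists>C. \<forall>x y. \<bar>\<phi> x - \<phi> y\<bar> \<le> C * L2_set (\<lambda>i. x i - y i) {..<n})}"

text \<open>
  The sample space is \<open>space M\<close> and the \<open>\<sigma>\<close>-algebra is \<open>sets M\<close>; the measure carried by \<open>M\<close> plays
  no role. Functions on the sample space are compared on \<open>space M\<close> only, so by \<open>mono\<close> the value
  \<open>E X\<close> is determined by the restriction of \<open>X\<close> to \<open>space M\<close>. Constants belong to \<open>H\<close> by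
  \<open>Lip_closed\<close>. In \<open>scale\<close>, the product of \<open>0\<close> and an infinite value is \<open>0\<close>.
\<close>

locale sublinear_expectation_space =
  fixes M :: "'a measure"
    and H :: "('a \<Rightarrow> real) set"
    and E :: "('a \<Rightarrow> real) \<Rightarrow> ereal"
  assumes H_measurable: "H \<subseteq> borel_measurable M"
    and H_zero: "(\<lambda>\<omega>. 0) \<in> H"
    and H_add: "\<And>X Y. X \<in> H \<Longrightarrow> Y \<in> H \<Longrightarrow> (\<lambda>\<omega>. X \<omega> + Y \<omega>) \<in> H"
    and H_scale: "\<And>(c::real) X. X \<in> H \<Longrightarrow> (\<lambda>\<omega>. c * X \<omega>) \<in> H"
    and Lip_closed: "\<And>(n::nat) X \<phi>. (\<And>i. i < n \<Longrightarrow> X i \<in> H) \<Longrightarrow> \<phi> \<in> C_l_Lip n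
          \<Longrightarrow> (\<lambda>\<omega>. \<phi> (\<lambda>i. X i \<omega>)) \<in> H"
    and mono: "\<And>X Y. X \<in> H \<Longrightarrow> Y \<in> H \<Longrightarrow> (\<And>\<omega>. \<omega> \<in> space M \<Longrightarrow> Y \<omega> \<le> X \<omega>) \<Longrightarrow> E Y \<le> E X"
    and const: "\<And>c::real. E (\<lambda>\<omega>. c) = ereal c"
    and subadd: "\<And>X Y. X \<in> H \<Longrightarrow> Y \<in> H
          \<Longrightarrow> \<not> (E X = \<infinity> \<and> E Y = -\<infinity>) \<Longrightarrow> \<not> (E X = -\<infinity> \<and> E Y = \<infinity>)
          \<Longrightarrow> E (\<lambda>\<omega>. X \<omega> + Y \<omega>) \<le> E X + E Y"
    and scale: "\<And>(c::real) X. X \<in> H \<Longrightarrow> 0 \<le> c \<Longrightarrow> E (\<lambda>\<omega>. c * X \<omega>) = ereal c * E X"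

definition upper_capacity ::
    "'a measure \<Rightarrow> ('a \<Rightarrow> real) set \<Rightarrow> (('a \<Rightarrow> real) \<Rightarrow> ereal) \<Rightarrow> 'a set \<Rightarrow> ereal" where
  "upper_capacity M H E A = Inf {E \<xi> | \<xi>. \<xi> \<in> H \<and> (\<forall>\<omega>\<in>space M. indicator A \<omega> \<le> \<xi> \<omega>)}"

definition countably_subadditive_capacity :: "'a measure \<Rightarrow> ('a set \<Rightarrow> ereal) \<Rightarrow> bool" where
  "countably_subadditive_capacity M V \<longleftrightarrow>
     (\<forall>A::nat \<Rightarrow> 'a set. range A \<subseteq> sets M \<longrightarrow> V (\<Union>n. A n) \<le> (\<Sum>n. V (A n)))"

text \<open>
  The upper capacity is monotone, so that convergence along a monotone sequence of events is
  automatically monotone.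
\<close>

definition continuous_capacity :: "'a measure \<Rightarrow> ('a set \<Rightarrow> ereal) \<Rightarrow> bool" where
  "continuous_capacity M V \<longleftrightarrow>
     (\<forall>A::nat \<Rightarrow> 'a set. range A \<subseteq> sets M \<longrightarrow> incseq A \<longrightarrow> (\<lambda>n. V (A n)) \<longlonglongrightarrow> V (\<Union>n. A n)) \<and>
     (\<forall>A::nat \<Rightarrow> 'a set. range A \<subseteq> sets M \<longrightarrow> decseq A \<longrightarrow> (\<lambda>n. V (A n)) \<longlonglongrightarrow> V (\<Inter>n. A n))"

text \<open>The point of \<open>(m + n)\<close>-space whose first \<open>m\<close> coordinates are \<open>x\<close> and whose last \<open>n\<close> are \<open>y\<close>.\<close>

definition vec_pair :: "nat \<Rightarrow> (nat \<Rightarrow> real) \<Rightarrow> (nat \<Rightarrow> real) \<Rightarrow> (nat \<Rightarrow> real)" where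
  "vec_pair m x y = (\<lambda>i. if i < m then x i else y (i - m))"

text \<open>
  \<open>indep_to H E n Y m X\<close>: the vector \<open>(Y 0, ..., Y (n - 1))\<close> is independent to
  \<open>(X 0, ..., X (m - 1))\<close>. The test function is bounded, hence the inner expectation is finite and
  \<open>real_of_ereal\<close> loses nothing.
\<close>

definition indep_to ::
    "('a \<Rightarrow> real) set \<Rightarrow> (('a \<Rightarrow> real) \<Rightarrow> ereal) \<Rightarrow>
     nat \<Rightarrow> (nat \<Rightarrow> 'a \<Rightarrow> real) \<Rightarrow> nat \<Rightarrow> (nat \<Rightarrow> 'a \<Rightarrow> real) \<Rightarrow> bool" where
  "indep_to H E n Y m X \<longleftrightarrow>
     (\<forall>i<n. Y i \<in> H) \<and> (\<forall>i<m. X i \<in> H) \<and>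
     (\<forall>\<phi>\<in>C_b_Lip (m + n).
        E (\<lambda>\<omega>. \<phi> (vec_pair m (\<lambda>i. X i \<omega>) (\<lambda>i. Y i \<omega>))) =
        E (\<lambda>\<omega>. real_of_ereal (E (\<lambda>\<omega>'. \<phi> (vec_pair m (\<lambda>i. X i \<omega>) (\<lambda>i. Y i \<omega>'))))))"

text \<open>Sequences are indexed from \<open>1\<close>; the value \<open>X 0\<close> is irrelevant.\<close>

definition independent_seq ::
    "('a \<Rightarrow> real) set \<Rightarrow> (('a \<Rightarrow> real) \<Rightarrow> ereal) \<Rightarrow> (nat \<Rightarrow> 'a \<Rightarrow> real) \<Rightarrow> bool" where
  "independent_seq H E X \<longleftrightarrow>
     (\<forall>n\<ge>1. X n \<in> H) \<and>
     (\<forall>i\<ge>1. indep_to H E 1 (\<lambda>_. X (i + 1)) i (\<lambda>j. X (j + 1)))"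

end

theory Submission
  imports Defs
begin

text \<open>
  The passage from (B) to (A) is the classical one: the events \<open>\<exists>k\<ge>n. \<epsilon> \<le> \<bar>S\<^sub>k - S\<bar>\<close> decrease to a subset
  of the set where \<open>S\<^sub>n\<close> fails to converge to \<open>S\<close>, and continuity from above forces their capacities
  to tend to \<open>0\<close> (\<open>converges_in_capacity\<close>).

  The passage from (A) to (B) rests on a maximal inequality of Ottaviani type (\<open>maximal_inequality\<close>): if every increment
  \<open>S\<^sub>n - S\<^sub>k\<close> of a block \<open>m \<le> k \<le> n\<close> exceeds \<open>\<delta>\<close> with capacity at most \<open>\<alpha> < 1\<close>, then
  \<open>max\<^sub>k \<bar>S\<^sub>k - S\<^sub>m\<bar>\<close> is controlled by the last increment \<open>S\<^sub>n - S\<^sub>m\<close> alone. The classical proof splits the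
  maximal event by the first time \<open>k\<close> at which the walk is far from \<open>S\<^sub>m\<close>, and uses that \<open>S\<^sub>n - S\<^sub>k\<close> is
  independent of that event. Two features of the sub-linear setting change it. Independence concerns
  Lipschitz test functions only, so the indicators of the first exit become Lipschitz weights
  \<open>f\<^sub>k \<ge> 0\<close>, functions of the past with \<open>\<Sum> f\<^sub>k \<le> 1\<close>. And sub-additivity gives upper bounds only, so
  \<open>E[\<Sum> f\<^sub>k]\<close> may be smaller than the sum of the \<open>E[f\<^sub>k]\<close>; instead one subtracts centred terms.
  With \<open>q\<^sub>k\<close> a Lipschitz version of the indicator of \<open>\<bar>S\<^sub>n - S\<^sub>k\<bar> > \<delta>\<close>,
  \<open>(1 - \<alpha>) (\<Sum> f\<^sub>k) = (\<Sum> f\<^sub>k (1 - q\<^sub>k)) + (\<Sum> f\<^sub>k (q\<^sub>k - \<alpha>))\<close>.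
  Each \<open>f\<^sub>k (q\<^sub>k - \<alpha>)\<close> has expectation at most \<open>0\<close>, because conditionally on the past it is
  \<open>f\<^sub>k \<ge> 0\<close> times \<open>E[q\<^sub>k] - \<alpha> \<le> 0\<close> (\<open>E_past_times_future\<close>), and the first sum is at most the indicator
  of \<open>\<bar>S\<^sub>n - S\<^sub>m\<bar> \<ge> \<delta>\<close>.

  Countable sub-additivity does not imply continuity from below, so the maximal inequality cannot be
  passed to infinite blocks. It is applied to consecutive finite blocks whose thresholds and
  capacities are both of order \<open>2\<^sup>-\<^sup>j\<close>. The exceptional set lies in the union of the bad events of all
  blocks from any index \<open>J\<close> on, hence has capacity \<open>O(2\<^sup>-\<^sup>J)\<close> (\<open>converges_quasi_surely\<close>).
\<close>

section \<open>Bounded Lipschitz test functions\<close>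

definition bounded_lipschitz :: "(real \<Rightarrow> real) \<Rightarrow> bool" where
  "bounded_lipschitz u \<longleftrightarrow>
     (\<exists>K. \<forall>x. \<bar>u x\<bar> \<le> K) \<and> (\<exists>L. \<forall>x y. \<bar>u x - u y\<bar> \<le> L * \<bar>x - y\<bar>)"

lemma bounded_lipschitz_nonneg_const:
  assumes "bounded_lipschitz u"
  obtains K L where "\<And>x. \<bar>u x\<bar> \<le> K" "0 \<le> L" "\<And>x y. \<bar>u x - u y\<bar> \<le> L * \<bar>x - y\<bar>"
proof -
  obtain K L where K: "\<And>x. \<bar>u x\<bar> \<le> K" and L: "\<And>x y. \<bar>u x - u y\<bar> \<le> L * \<bar>x - y\<bar>"
    using assms unfolding bounded_lipschitz_def by blast
  have "\<bar>u 1 - u 0\<bar> \<le> L" using L[of 1 0] by simp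
  hence "0 \<le> L" by linarith
  with K L that show thesis by blast
qed

lemma bounded_lipschitz_diff_const:
  assumes "bounded_lipschitz u"
  shows "bounded_lipschitz (\<lambda>x. u x - c)"
proof -
  obtain K L where K: "\<And>x. \<bar>u x\<bar> \<le> K" and L: "\<And>x y. \<bar>u x - u y\<bar> \<le> L * \<bar>x - y\<bar>"
    using assms unfolding bounded_lipschitz_def by blast
  have "\<bar>u x - c\<bar> \<le> K + \<bar>c\<bar>" for x using K[of x] by linarith
  with L show ?thesis unfolding bounded_lipschitz_def by auto
qed

lemma bounded_lipschitz_shift:
  assumes "bounded_lipschitz u"
  shows "bounded_lipschitz (\<lambda>x. u (s + x))"
proof -
  obtain K L where K: "\<And>x. \<bar>u x\<bar> \<le> K" and L: "\<And>x y. \<bar>u x - u y\<bar> \<le> L * \<bar>x - y\<bar>"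
    using assms unfolding bounded_lipschitz_def by blast
  have "\<bar>u (s + x) - u (s + y)\<bar> \<le> L * \<bar>x - y\<bar>" for x y
    using L[of "s + x" "s + y"] by simp
  with K show ?thesis unfolding bounded_lipschitz_def by auto
qed

text \<open>A Lipschitz substitute for the indicator of \<open>\<bar>x\<bar> > \<delta>\<close>: it rises from \<open>0\<close> to \<open>1\<close> on \<open>\<delta> \<le> \<bar>x\<bar> \<le> 2 * \<delta>\<close>.\<close>

definition ramp :: "real \<Rightarrow> real \<Rightarrow> real" where
  "ramp \<delta> x = min 1 (max 0 (\<bar>x\<bar> / \<delta> - 1))"

lemma ramp_nonneg: "0 \<le> ramp \<delta> x" and ramp_le_1: "ramp \<delta> x \<le> 1"
  by (auto simp: ramp_def)

lemma ramp_eq_0: "0 < \<delta> \<Longrightarrow> \<bar>x\<bar> \<le> \<delta> \<Longrightarrow> ramp \<delta> x = 0"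
  by (auto simp: ramp_def max_def divide_simps)

lemma ramp_eq_1: "0 < \<delta> \<Longrightarrow> 2 * \<delta> \<le> \<bar>x\<bar> \<Longrightarrow> ramp \<delta> x = 1"
  by (auto simp: ramp_def max_def min_def divide_simps)

lemma bounded_lipschitz_ramp:
  assumes "0 < \<delta>"
  shows "bounded_lipschitz (ramp \<delta>)"
proof -
  have "\<bar>ramp \<delta> x - ramp \<delta> y\<bar> \<le> (1 / \<delta>) * \<bar>x - y\<bar>" for x y
  proof -
    have "\<bar>ramp \<delta> x - ramp \<delta> y\<bar> \<le> \<bar>\<bar>x\<bar> / \<delta> - \<bar>y\<bar> / \<delta>\<bar>"
      unfolding ramp_def by linarith
    also have "\<dots> = \<bar>\<bar>x\<bar> - \<bar>y\<bar>\<bar> / \<delta>"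
      using assms by (simp flip: diff_divide_distrib)
    also have "\<dots> \<le> \<bar>x - y\<bar> / \<delta>"
      using assms by (intro divide_right_mono) auto
    finally show ?thesis by simp
  qed
  moreover have "\<bar>ramp \<delta> x\<bar> \<le> 1" for x
    using ramp_nonneg[of \<delta> x] ramp_le_1[of \<delta> x] by simp
  ultimately show ?thesis unfolding bounded_lipschitz_def by blast
qed

lemma C_b_LipI:
  assumes "\<And>x. \<bar>\<phi> x\<bar> \<le> K"
    and "\<And>x y. \<bar>\<phi> x - \<phi> y\<bar> \<le> C * L2_set (\<lambda>i. x i - y i) {..<n}"
  shows "\<phi> \<in> C_b_Lip n"
  using assms unfolding C_b_Lip_def by blast

lemma C_b_LipE:
  assumes "\<phi> \<in> C_b_Lip n"
  obtains K C where "\<And>x. \<bar>\<phi> x\<bar> \<le> K" "0 \<le> C"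
    "\<And>x y. \<bar>\<phi> x - \<phi> y\<bar> \<le> C * L2_set (\<lambda>i. x i - y i) {..<n}"
proof -
  obtain K C where K: "\<And>x. \<bar>\<phi> x\<bar> \<le> K"
    and C: "\<And>x y. \<bar>\<phi> x - \<phi> y\<bar> \<le> C * L2_set (\<lambda>i. x i - y i) {..<n}"
    using assms unfolding C_b_Lip_def by blast
  have "\<bar>\<phi> x - \<phi> y\<bar> \<le> \<bar>C\<bar> * L2_set (\<lambda>i. x i - y i) {..<n}" for x y
    by (rule order_trans[OF C]) (simp add: mult_right_mono)
  with K that[of K "\<bar>C\<bar>"] show thesis by simp
qed

lemma C_b_Lip_const: "(\<lambda>_. c) \<in> C_b_Lip n"
  by (rule C_b_LipI[of _ "\<bar>c\<bar>" 0]) auto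

lemma C_b_Lip_depends:
  assumes "\<phi> \<in> C_b_Lip n" and "\<And>i. i < n \<Longrightarrow> x i = y i"
  shows "\<phi> x = \<phi> y"
proof -
  have "L2_set (\<lambda>i. x i - y i) {..<n} = 0"
    using assms(2) by (simp add: L2_set_eq_0_iff)
  with assms(1) have "\<bar>\<phi> x - \<phi> y\<bar> \<le> 0"
    by (metis C_b_LipE mult_zero_right)
  thus ?thesis by simp
qed

lemma C_b_Lip_mono:
  assumes "\<phi> \<in> C_b_Lip k" and "k \<le> n"
  shows "\<phi> \<in> C_b_Lip n"
proof -
  obtain K C where K: "\<And>x. \<bar>\<phi> x\<bar> \<le> K" and "0 \<le> C"
    and C: "\<And>x y. \<bar>\<phi> x - \<phi> y\<bar> \<le> C * L2_set (\<lambda>i. x i - y i) {..<k}"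
    using C_b_LipE[OF assms(1)] by metis
  have "L2_set h {..<k} \<le> L2_set h {..<n}" for h
    using assms(2) unfolding L2_set_def
    by (intro real_sqrt_le_mono sum_mono2) auto
  hence "\<bar>\<phi> x - \<phi> y\<bar> \<le> C * L2_set (\<lambda>i. x i - y i) {..<n}" for x y
    by (rule order_trans[OF C mult_left_mono[OF _ \<open>0 \<le> C\<close>]])
  with K show ?thesis by (rule C_b_LipI)
qed

lemma C_b_Lip_diff:
  assumes "\<phi> \<in> C_b_Lip n" and "\<psi> \<in> C_b_Lip n"
  shows "(\<lambda>x. \<phi> x - \<psi> x) \<in> C_b_Lip n"
proof -
  obtain K C where K: "\<And>x. \<bar>\<phi> x\<bar> \<le> K"
    and C: "\<And>x y. \<bar>\<phi> x - \<phi> y\<bar> \<le> C * L2_set (\<lambda>i. x i - y i) {..<n}"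
    using C_b_LipE[OF assms(1)] by metis
  obtain K' C' where K': "\<And>x. \<bar>\<psi> x\<bar> \<le> K'"
    and C': "\<And>x y. \<bar>\<psi> x - \<psi> y\<bar> \<le> C' * L2_set (\<lambda>i. x i - y i) {..<n}"
    using C_b_LipE[OF assms(2)] by metis
  show ?thesis
  proof (rule C_b_LipI)
    show "\<bar>\<phi> x - \<psi> x\<bar> \<le> K + K'" for x
      using K[of x] K'[of x] by linarith
    show "\<bar>(\<phi> x - \<psi> x) - (\<phi> y - \<psi> y)\<bar> \<le> (C + C') * L2_set (\<lambda>i. x i - y i) {..<n}" for x y
      using C[of x y] C'[of x y] unfolding distrib_right by linarith
  qed
qed

lemma C_b_Lip_mult:
  assumes "\<phi> \<in> C_b_Lip n" and "\<psi> \<in> C_b_Lip n"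
  shows "(\<lambda>x. \<phi> x * \<psi> x) \<in> C_b_Lip n"
proof -
  obtain K C where K: "\<And>x. \<bar>\<phi> x\<bar> \<le> K"
    and C: "\<And>x y. \<bar>\<phi> x - \<phi> y\<bar> \<le> C * L2_set (\<lambda>i. x i - y i) {..<n}"
    using C_b_LipE[OF assms(1)] by metis
  obtain K' C' where K': "\<And>x. \<bar>\<psi> x\<bar> \<le> K'"
    and C': "\<And>x y. \<bar>\<psi> x - \<psi> y\<bar> \<le> C' * L2_set (\<lambda>i. x i - y i) {..<n}"
    using C_b_LipE[OF assms(2)] by metis
  have "0 \<le> K" "0 \<le> K'"
    using K[of undefined] K'[of undefined] by linarith+
  show ?thesis
  proof (rule C_b_LipI)
    show "\<bar>\<phi> x * \<psi> x\<bar> \<le> K * K'" for x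
      using K[of x] K'[of x] \<open>0 \<le> K\<close> by (simp add: abs_mult mult_mono)
    fix x y
    let ?d = "L2_set (\<lambda>i. x i - y i) {..<n}"
    have "\<phi> x * \<psi> x - \<phi> y * \<psi> y = \<phi> x * (\<psi> x - \<psi> y) + \<psi> y * (\<phi> x - \<phi> y)"
      by (simp add: algebra_simps)
    hence "\<bar>\<phi> x * \<psi> x - \<phi> y * \<psi> y\<bar>
        \<le> \<bar>\<phi> x\<bar> * \<bar>\<psi> x - \<psi> y\<bar> + \<bar>\<psi> y\<bar> * \<bar>\<phi> x - \<phi> y\<bar>"
      by (metis abs_mult abs_triangle_ineq)
    also have "\<dots> \<le> K * (C' * ?d) + K' * (C * ?d)"
      using K C K' C' \<open>0 \<le> K\<close> \<open>0 \<le> K'\<close> by (intro add_mono mult_mono) auto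
    finally show "\<bar>\<phi> x * \<psi> x - \<phi> y * \<psi> y\<bar> \<le> (K * C' + K' * C) * ?d"
      by (simp add: algebra_simps)
  qed
qed

lemma C_b_Lip_prod:
  assumes "finite I" and "\<And>i. i \<in> I \<Longrightarrow> \<phi> i \<in> C_b_Lip n"
  shows "(\<lambda>x. \<Prod>i\<in>I. \<phi> i x) \<in> C_b_Lip n"
  using assms by (induction I rule: finite_induct) (auto intro: C_b_Lip_const C_b_Lip_mult)

lemma C_b_Lip_block_sum:
  assumes "bounded_lipschitz u" and "b \<le> n"
  shows "(\<lambda>x. u (\<Sum>j=a..<b. x j)) \<in> C_b_Lip n"
proof -
  obtain K L where K: "\<And>x. \<bar>u x\<bar> \<le> K" and "0 \<le> L"
    and L: "\<And>x y. \<bar>u x - u y\<bar> \<le> L * \<bar>x - y\<bar>"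
    using bounded_lipschitz_nonneg_const[OF assms(1)] by metis
  show ?thesis
  proof (rule C_b_LipI)
    show "\<bar>u (\<Sum>j=a..<b. x j)\<bar> \<le> K" for x :: "nat \<Rightarrow> real"
      using K .
    fix x y :: "nat \<Rightarrow> real"
    let ?d = "L2_set (\<lambda>i. x i - y i) {..<n}"
    have "\<bar>(\<Sum>j=a..<b. x j) - (\<Sum>j=a..<b. y j)\<bar> \<le> (\<Sum>j=a..<b. \<bar>x j - y j\<bar>)"
      by (simp flip: sum_subtractf)
    also have "\<dots> \<le> (\<Sum>j=a..<b. ?d)"
    proof (intro sum_mono)
      fix j assume "j \<in> {a..<b}"
      hence "j \<in> {..<n}" using assms(2) by simp
      hence "\<bar>x j - y j\<bar> \<le> L2_set (\<lambda>i. \<bar>x i - y i\<bar>) {..<n}"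
        by (intro member_le_L2_set) auto
      thus "\<bar>x j - y j\<bar> \<le> ?d" by (simp add: L2_set_def)
    qed
    finally have "\<bar>(\<Sum>j=a..<b. x j) - (\<Sum>j=a..<b. y j)\<bar> \<le> real (b - a) * ?d"
      by simp
    from order_trans[OF L mult_left_mono[OF this \<open>0 \<le> L\<close>]]
    show "\<bar>u (\<Sum>j=a..<b. x j) - u (\<Sum>j=a..<b. y j)\<bar> \<le> (L * real (b - a)) * ?d"
      by (simp add: mult.assoc)
  qed
qed

lemma C_b_Lip_subset_C_l_Lip: "C_b_Lip n \<subseteq> C_l_Lip n"
proof
  fix \<phi> assume "\<phi> \<in> C_b_Lip n"
  then obtain C where "0 \<le> C"
    and C: "\<And>x y. \<bar>\<phi> x - \<phi> y\<bar> \<le> C * L2_set (\<lambda>i. x i - y i) {..<n}"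
    using C_b_LipE by metis
  have "\<bar>\<phi> x - \<phi> y\<bar> \<le> (C + 1) * (1 + L2_set x {..<n} ^ 0 + L2_set y {..<n} ^ 0)
      * L2_set (\<lambda>i. x i - y i) {..<n}" for x y
    by (rule order_trans[OF C mult_right_mono]) (use \<open>0 \<le> C\<close> in auto)
  moreover have "0 < C + 1" using \<open>0 \<le> C\<close> by simp
  ultimately show "\<phi> \<in> C_l_Lip n" unfolding C_l_Lip_def by blast
qed


section \<open>Sub-linear expectation of bounded random variables and the upper capacity\<close>

context sublinear_expectation_space
begin

text \<open>
  On bounded random variables \<open>E\<close> is finite, so the rules of sub-linear calculus hold without the
  provisos about \<open>\<infinity> - \<infinity>\<close>. Bounded Lipschitz functions of elements of \<open>H\<close> are of this kind.
\<close>

definition bounded_H :: "('a \<Rightarrow> real) set" where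
  "bounded_H = {Y \<in> H. \<exists>K. \<forall>\<omega>\<in>space M. \<bar>Y \<omega>\<bar> \<le> K}"

abbreviation V :: "'a set \<Rightarrow> ereal" where
  "V \<equiv> upper_capacity M H E"

lemma bounded_H_in_H: "Y \<in> bounded_H \<Longrightarrow> Y \<in> H"
  by (simp add: bounded_H_def)

lemma const_in_H: "(\<lambda>_. c) \<in> H"
proof -
  have "(\<lambda>_. c) \<in> C_l_Lip 0"
    unfolding C_l_Lip_def by (auto intro: exI[of _ 1])
  from Lip_closed[of 0, OF _ this] show ?thesis by simp
qed

lemma C_b_Lip_compose_bounded_H:
  assumes "\<phi> \<in> C_b_Lip n" and "\<And>i. i < n \<Longrightarrow> Y i \<in> H"
  shows "(\<lambda>\<omega>. \<phi> (\<lambda>i. Y i \<omega>)) \<in> bounded_H"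
proof -
  have "(\<lambda>\<omega>. \<phi> (\<lambda>i. Y i \<omega>)) \<in> H"
    using assms C_b_Lip_subset_C_l_Lip by (blast intro: Lip_closed[of n])
  moreover obtain K where "\<And>x. \<bar>\<phi> x\<bar> \<le> K"
    using C_b_LipE[OF assms(1)] by metis
  ultimately show ?thesis unfolding bounded_H_def by blast
qed

lemma bounded_lipschitz_compose_bounded_H:
  assumes "bounded_lipschitz u" and "Y \<in> H"
  shows "(\<lambda>\<omega>. u (Y \<omega>)) \<in> bounded_H"
  using C_b_Lip_compose_bounded_H[OF C_b_Lip_block_sum[OF assms(1), of 1 1 0], of "\<lambda>_. Y"] assms(2)
  by simp

lemma bounded_H_const: "(\<lambda>_. c) \<in> bounded_H"
  using const_in_H by (auto simp: bounded_H_def)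

lemma bounded_H_add:
  assumes "Y \<in> bounded_H" and "Z \<in> bounded_H"
  shows "(\<lambda>\<omega>. Y \<omega> + Z \<omega>) \<in> bounded_H"
proof -
  obtain K K' where K: "\<And>\<omega>. \<omega> \<in> space M \<Longrightarrow> \<bar>Y \<omega>\<bar> \<le> K" "\<And>\<omega>. \<omega> \<in> space M \<Longrightarrow> \<bar>Z \<omega>\<bar> \<le> K'"
    using assms unfolding bounded_H_def by blast
  have "\<bar>Y \<omega> + Z \<omega>\<bar> \<le> K + K'" if "\<omega> \<in> space M" for \<omega>
    using K[OF that] by linarith
  moreover have "(\<lambda>\<omega>. Y \<omega> + Z \<omega>) \<in> H"
    using assms by (intro H_add bounded_H_in_H)
  ultimately show ?thesis unfolding bounded_H_def by blast
qed

lemma bounded_H_scale: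
  assumes "Y \<in> bounded_H"
  shows "(\<lambda>\<omega>. c * Y \<omega>) \<in> bounded_H"
proof -
  obtain K where K: "\<And>\<omega>. \<omega> \<in> space M \<Longrightarrow> \<bar>Y \<omega>\<bar> \<le> K"
    using assms unfolding bounded_H_def by blast
  have "\<bar>c * Y \<omega>\<bar> \<le> \<bar>c\<bar> * K" if "\<omega> \<in> space M" for \<omega>
    using K[OF that] by (simp add: abs_mult mult_left_mono)
  moreover have "(\<lambda>\<omega>. c * Y \<omega>) \<in> H"
    using assms by (intro H_scale bounded_H_in_H)
  ultimately show ?thesis unfolding bounded_H_def by blast
qed

lemma bounded_H_sum:
  assumes "finite I" and "\<And>i. i \<in> I \<Longrightarrow> Y i \<in> bounded_H"
  shows "(\<lambda>\<omega>. \<Sum>i\<in>I. Y i \<omega>) \<in> bounded_H"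
  using assms by (induction I rule: finite_induct) (auto intro: bounded_H_const bounded_H_add)

lemma abs_E_le:
  assumes "Y \<in> H" and "\<And>\<omega>. \<omega> \<in> space M \<Longrightarrow> \<bar>Y \<omega>\<bar> \<le> K"
  shows "\<bar>E Y\<bar> \<le> ereal K"
proof -
  have "- K \<le> Y \<omega> \<and> Y \<omega> \<le> K" if "\<omega> \<in> space M" for \<omega>
    using assms(2)[OF that] by linarith
  hence "E (\<lambda>_. - K) \<le> E Y" "E Y \<le> E (\<lambda>_. K)"
    using assms(1) by (auto intro!: mono const_in_H)
  thus ?thesis unfolding const by (cases "E Y") auto
qed

lemma E_bounded_H:
  assumes "Y \<in> bounded_H"
  shows "ereal (real_of_ereal (E Y)) = E Y"
proof -
  obtain K where "\<bar>E Y\<bar> \<le> ereal K"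
    using assms abs_E_le unfolding bounded_H_def by blast
  thus ?thesis by (cases "E Y") auto
qed

lemma E_add_le:
  assumes "Y \<in> bounded_H" and "Z \<in> bounded_H"
  shows "E (\<lambda>\<omega>. Y \<omega> + Z \<omega>) \<le> E Y + E Z"
proof (rule subadd)
  show "\<not> (E Y = \<infinity> \<and> E Z = -\<infinity>)" "\<not> (E Y = -\<infinity> \<and> E Z = \<infinity>)"
    using E_bounded_H[OF assms(1)] by auto
qed (use assms in \<open>auto intro: bounded_H_in_H\<close>)

lemma E_sum_le:
  assumes "finite I" and "\<And>i. i \<in> I \<Longrightarrow> Y i \<in> bounded_H"
  shows "E (\<lambda>\<omega>. \<Sum>i\<in>I. Y i \<omega>) \<le> (\<Sum>i\<in>I. E (Y i))"
  using assms
proof (induction I rule: finite_induct)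
  case empty
  show ?case using const[of 0] by (simp add: zero_ereal_def)
next
  case (insert i I)
  have "E (\<lambda>\<omega>. Y i \<omega> + (\<Sum>i\<in>I. Y i \<omega>)) \<le> E (Y i) + E (\<lambda>\<omega>. \<Sum>i\<in>I. Y i \<omega>)"
    using insert by (intro E_add_le bounded_H_sum) auto
  also have "\<dots> \<le> E (Y i) + (\<Sum>i\<in>I. E (Y i))"
    using insert by (intro add_left_mono) auto
  finally show ?case using insert by simp
qed

text \<open>
  Sub-additivity is an equality when one summand is constant, since the constant can be subtracted
  again. This makes centring compatible with \<open>E\<close>.
\<close>

lemma E_add_const:
  assumes "Y \<in> bounded_H"
  shows "E (\<lambda>\<omega>. Y \<omega> + c) = E Y + ereal c"
proof (rule antisym)
  show "E (\<lambda>\<omega>. Y \<omega> + c) \<le> E Y + ereal c"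
    using E_add_le[OF assms bounded_H_const[of c]] by (simp add: const)
  let ?Z = "\<lambda>\<omega>. Y \<omega> + c"
  have Z: "?Z \<in> bounded_H" by (intro bounded_H_add bounded_H_const assms)
  have "E Y \<le> E ?Z + ereal (- c)"
    using E_add_le[OF Z bounded_H_const[of "- c"]] by (simp add: const)
  thus "E Y + ereal c \<le> E ?Z"
    by (cases "E Y"; cases "E ?Z") auto
qed

text \<open>
  This makes \<open>s \<mapsto> E[u(s + Y)]\<close> Lipschitz for Lipschitz \<open>u\<close>, so that a partially integrated test
  function is again a test function.
\<close>

lemma E_Lipschitz:
  assumes "Y \<in> bounded_H" and "Z \<in> bounded_H"
    and "\<And>\<omega>. \<omega> \<in> space M \<Longrightarrow> \<bar>Y \<omega> - Z \<omega>\<bar> \<le> d"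
  shows "\<bar>real_of_ereal (E Y) - real_of_ereal (E Z)\<bar> \<le> d"
proof -
  have *: "real_of_ereal (E Y) \<le> real_of_ereal (E Z) + d"
    if "Y \<in> bounded_H" "Z \<in> bounded_H" "\<And>\<omega>. \<omega> \<in> space M \<Longrightarrow> \<bar>Y \<omega> - Z \<omega>\<bar> \<le> d" for Y Z
  proof -
    have "E Y \<le> E (\<lambda>\<omega>. Z \<omega> + d)"
    proof (rule mono)
      show "Y \<omega> \<le> Z \<omega> + d" if "\<omega> \<in> space M" for \<omega>
        using \<open>\<And>\<omega>. \<omega> \<in> space M \<Longrightarrow> \<bar>Y \<omega> - Z \<omega>\<bar> \<le> d\<close>[OF that] by linarith
    qed (intro bounded_H_in_H bounded_H_add bounded_H_const that)+
    also have "\<dots> = E Z + ereal d" by (rule E_add_const) fact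
    finally have "ereal (real_of_ereal (E Y)) \<le> ereal (real_of_ereal (E Z)) + ereal d"
      unfolding E_bounded_H[OF that(1)] E_bounded_H[OF that(2)] .
    thus ?thesis by simp
  qed
  have "\<bar>Z \<omega> - Y \<omega>\<bar> \<le> d" if "\<omega> \<in> space M" for \<omega>
    using assms(3)[OF that] by linarith
  from *[OF assms] *[OF assms(2,1) this] show ?thesis by linarith
qed

text \<open>
  \<open>V_le_E\<close> and \<open>E_le_V\<close> are the only bridge between events and test functions: an event is squeezed
  between random variables in \<open>H\<close>, as its own indicator need not belong to \<open>H\<close>.
\<close>

lemma V_le_E:
  assumes "\<xi> \<in> H" and "\<And>\<omega>. \<omega> \<in> space M \<Longrightarrow> indicator A \<omega> \<le> \<xi> \<omega>"
  shows "V A \<le> E \<xi>"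
  using assms unfolding upper_capacity_def by (intro Inf_lower) auto

lemma E_le_V:
  assumes "Y \<in> H" and "\<And>\<omega>. \<omega> \<in> space M \<Longrightarrow> Y \<omega> \<le> indicator A \<omega>"
  shows "E Y \<le> V A"
  unfolding upper_capacity_def
proof (rule Inf_greatest, safe)
  fix \<xi> assume "\<xi> \<in> H" "\<forall>\<omega>\<in>space M. indicator A \<omega> \<le> \<xi> \<omega>"
  thus "E Y \<le> E \<xi>" using assms by (intro mono) (auto intro: order_trans)
qed

lemma V_nonneg: "0 \<le> V A"
  using E_le_V[OF const_in_H[of 0]] by (simp add: const zero_ereal_def)

lemma V_mono:
  assumes "A \<subseteq> B"
  shows "V A \<le> V B"
  unfolding upper_capacity_def
proof (rule Inf_superset_mono, safe)
  fix \<xi> assume \<xi>: "\<xi> \<in> H" "\<forall>\<omega>\<in>space M. indicator B \<omega> \<le> \<xi> \<omega>"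
  have "indicator A \<omega> \<le> (indicator B \<omega> :: real)" for \<omega>
    using assms by (auto simp: indicator_def)
  with \<xi> show "\<exists>\<xi>'. E \<xi> = E \<xi>' \<and> \<xi>' \<in> H \<and> (\<forall>\<omega>\<in>space M. indicator A \<omega> \<le> \<xi>' \<omega>)"
    by (blast intro: order_trans)
qed

lemma V_empty: "V {} = 0"
  using V_le_E[OF const_in_H[of 0], of "{}"] V_nonneg[of "{}"]
  by (simp add: const zero_ereal_def)

lemma V_Un_le:
  assumes "countably_subadditive_capacity M V" and "A \<in> sets M" and "B \<in> sets M"
  shows "V (A \<union> B) \<le> V A + V B"
proof -
  have "range (binaryset A B) \<subseteq> sets M"
    using assms(2,3) by (simp add: range_binaryset_eq)
  hence "V (\<Union>n. binaryset A B n) \<le> (\<Sum>n. V (binaryset A B n))"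
    using assms(1) unfolding countably_subadditive_capacity_def by blast
  thus ?thesis by (simp add: UN_binaryset_eq suminf_binaryset_eq V_empty)
qed

end


section \<open>Independence of the future from the past\<close>

locale independent_sequence = sublinear_expectation_space M H E
  for M :: "'a measure" and H :: "('a \<Rightarrow> real) set" and E :: "('a \<Rightarrow> real) \<Rightarrow> ereal" +
  fixes X :: "nat \<Rightarrow> 'a \<Rightarrow> real"
  assumes indep: "independent_seq H E X"
begin

definition psum :: "nat \<Rightarrow> 'a \<Rightarrow> real" where
  "psum n \<omega> = (\<Sum>k=1..n. X k \<omega>)"

lemma X_in_H: "1 \<le> n \<Longrightarrow> X n \<in> H"
  using indep by (simp add: independent_seq_def)

lemma psum_measurable [measurable]: "psum n \<in> borel_measurable M"
proof -
  have "X k \<in> borel_measurable M" if "k \<in> {1..n}" for k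
    using X_in_H[of k] H_measurable that by auto
  thus ?thesis unfolding psum_def[abs_def] by (intro borel_measurable_sum)
qed

lemma psum_diff:
  assumes "k \<le> n"
  shows "psum n \<omega> - psum k \<omega> = (\<Sum>j=k..<n. X (j + 1) \<omega>)"
  using assms by (induction n rule: dec_induct) (auto simp: psum_def)

lemma C_b_Lip_past_bounded_H:
  assumes "\<phi> \<in> C_b_Lip n"
  shows "(\<lambda>\<omega>. \<phi> (\<lambda>j. X (j + 1) \<omega>)) \<in> bounded_H"
  using assms by (rule C_b_Lip_compose_bounded_H) (simp add: X_in_H)

text \<open>
  Integrating out the last variable \<open>X\<^sub>n\<^sub>+\<^sub>1\<close> alone. The weight \<open>f\<close> depends on \<open>X\<^sub>1, \<dots>, X\<^sub>k\<close> only, so it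
  is a constant for the inner expectation, and leaves it by positive homogeneity; this is where
  \<open>f \<ge> 0\<close> enters. Coordinates of test functions start at \<open>0\<close>, whence the shift in \<open>X (j + 1)\<close>.
\<close>

lemma E_past_times_increment:
  assumes "1 \<le> n" and "k \<le> n" and f: "f \<in> C_b_Lip k" "\<And>z. 0 \<le> f z" and u: "bounded_lipschitz u"
  shows "E (\<lambda>\<omega>. f (\<lambda>j. X (j + 1) \<omega>) * u (\<Sum>j=k..<Suc n. X (j + 1) \<omega>)) =
    E (\<lambda>\<omega>. f (\<lambda>j. X (j + 1) \<omega>) *
      real_of_ereal (E (\<lambda>\<omega>'. u ((\<Sum>j=k..<n. X (j + 1) \<omega>) + X (n + 1) \<omega>'))))"
proof -
  let ?\<phi> = "\<lambda>z. f z * u (\<Sum>j=k..<Suc n. z j)"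
  have \<phi>_Lip: "?\<phi> \<in> C_b_Lip (n + 1)"
    using \<open>k \<le> n\<close> by (intro C_b_Lip_mult C_b_Lip_mono[OF f(1)] C_b_Lip_block_sum[OF u]) auto
  have indep_n: "indep_to H E 1 (\<lambda>_. X (n + 1)) n (\<lambda>j. X (j + 1))"
    using indep \<open>1 \<le> n\<close> by (simp add: independent_seq_def)
  have eq: "E (\<lambda>\<omega>. ?\<phi> (vec_pair n (\<lambda>j. X (j + 1) \<omega>) (\<lambda>_. X (n + 1) \<omega>))) =
      E (\<lambda>\<omega>. real_of_ereal (E (\<lambda>\<omega>'. ?\<phi> (vec_pair n (\<lambda>j. X (j + 1) \<omega>) (\<lambda>_. X (n + 1) \<omega>')))))"
    by (rule bspec[OF conjunct2[OF conjunct2[OF indep_n[unfolded indep_to_def]]] \<phi>_Lip])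
  have \<phi>: "?\<phi> (vec_pair n x (\<lambda>_. y)) = f x * u ((\<Sum>j=k..<n. x j) + y)" for x y
  proof -
    have "f (vec_pair n x (\<lambda>_. y)) = f x"
      using \<open>k \<le> n\<close> by (intro C_b_Lip_depends[OF f(1)]) (simp add: vec_pair_def)
    thus ?thesis using \<open>k \<le> n\<close> by (simp add: vec_pair_def)
  qed
  have "E (\<lambda>\<omega>'. f x * u (s + X (n + 1) \<omega>')) = ereal (f x) * E (\<lambda>\<omega>'. u (s + X (n + 1) \<omega>'))" for x s
    by (rule scale[OF bounded_H_in_H[OF
        bounded_lipschitz_compose_bounded_H[OF bounded_lipschitz_shift[OF u] X_in_H]] f(2)]) simp
  with eq show ?thesis
    unfolding \<phi> using \<open>k \<le> n\<close> by simp
qed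

text \<open>
  Independence of a single variable from its past yields independence of a whole block of increments:
  integrating out \<open>X\<^sub>n\<^sub>+\<^sub>1\<close> replaces \<open>u\<close> by \<open>v s = E[u(s + X\<^sub>n\<^sub>+\<^sub>1)]\<close>, again bounded and Lipschitz, and
  shortens the block by one. The induction therefore generalises over \<open>u\<close>.
\<close>

lemma E_past_times_future:
  assumes "1 \<le> k" and "k \<le> n" and "f \<in> C_b_Lip k" "\<And>z. 0 \<le> f z" and "bounded_lipschitz u"
  shows "E (\<lambda>\<omega>. f (\<lambda>j. X (j + 1) \<omega>) * u (\<Sum>j=k..<n. X (j + 1) \<omega>)) =
    E (\<lambda>\<omega>. f (\<lambda>j. X (j + 1) \<omega>) * real_of_ereal (E (\<lambda>\<omega>'. u (\<Sum>j=k..<n. X (j + 1) \<omega>'))))"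
  using assms(2,3,4,5)
proof (induction n arbitrary: f u rule: dec_induct)
  case base
  show ?case by (simp add: const)
next
  case (step n)
  define v where "v s = real_of_ereal (E (\<lambda>\<omega>'. u (s + X (n + 1) \<omega>')))" for s
  have Xn: "X (n + 1) \<in> H" by (rule X_in_H) simp
  have uX: "(\<lambda>\<omega>'. u (s + X (n + 1) \<omega>')) \<in> bounded_H" for s
    using bounded_lipschitz_compose_bounded_H[OF bounded_lipschitz_shift[OF step.prems(3)] Xn] .
  have v: "bounded_lipschitz v"
  proof -
    obtain K L where K: "\<And>x. \<bar>u x\<bar> \<le> K" and "0 \<le> L"
      and L: "\<And>x y. \<bar>u x - u y\<bar> \<le> L * \<bar>x - y\<bar>"
      using bounded_lipschitz_nonneg_const[OF step.prems(3)] by metis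
    have "\<bar>v s\<bar> \<le> K" for s
    proof -
      have "\<bar>E (\<lambda>\<omega>'. u (s + X (n + 1) \<omega>'))\<bar> \<le> ereal K"
        using K by (intro abs_E_le bounded_H_in_H uX)
      thus ?thesis unfolding v_def by (cases "E (\<lambda>\<omega>'. u (s + X (n + 1) \<omega>'))") auto
    qed
    moreover have "\<bar>v s - v t\<bar> \<le> L * \<bar>s - t\<bar>" for s t
      unfolding v_def
    proof (rule E_Lipschitz[OF uX uX])
      show "\<bar>u (s + X (n + 1) \<omega>) - u (t + X (n + 1) \<omega>)\<bar> \<le> L * \<bar>s - t\<bar>" for \<omega>
        using L[of "s + X (n + 1) \<omega>" "t + X (n + 1) \<omega>"] by simp
    qed
    ultimately show ?thesis unfolding bounded_lipschitz_def by blast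
  qed
  \<comment> \<open>The weight \<open>1\<close> identifies the expectation of \<open>v\<close> on the short block with that of \<open>u\<close> on the long one.\<close>
  have n: "1 \<le> n" "k \<le> n" using assms(1) step.hyps by auto
  have one: "(\<lambda>_. 1) \<in> C_b_Lip k" "\<And>z::nat \<Rightarrow> real. (0::real) \<le> 1"
    by (auto intro: C_b_Lip_const)
  have "E (\<lambda>\<omega>. u (\<Sum>j=k..<Suc n. X (j + 1) \<omega>)) = E (\<lambda>\<omega>. v (\<Sum>j=k..<n. X (j + 1) \<omega>))"
    using E_past_times_increment[OF n one step.prems(3)] by (simp add: v_def)
  moreover have "E (\<lambda>\<omega>. f (\<lambda>j. X (j + 1) \<omega>) * u (\<Sum>j=k..<Suc n. X (j + 1) \<omega>)) =
      E (\<lambda>\<omega>. f (\<lambda>j. X (j + 1) \<omega>) * v (\<Sum>j=k..<n. X (j + 1) \<omega>))"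
    unfolding v_def by (rule E_past_times_increment[OF n step.prems])
  ultimately show ?case
    using step.IH[OF step.prems(1,2) v] by simp
qed


section \<open>The maximal inequality\<close>

text \<open>
  The threshold \<open>6 * \<delta>\<close> pays for the two smoothings: the Lipschitz version of \<open>\<bar>S\<^sub>n - S\<^sub>k\<bar> > \<delta>\<close> reaches \<open>1\<close>
  only at \<open>2 * \<delta>\<close>, so that exits have to be counted from \<open>3 * \<delta>\<close> on to leave \<open>\<delta>\<close> for the last
  increment, and the Lipschitz version of \<open>\<bar>S\<^sub>k - S\<^sub>m\<bar> > 3 * \<delta>\<close> reaches \<open>1\<close> only at \<open>6 * \<delta>\<close>.
\<close>

lemma maximal_inequality:
  assumes "1 \<le> m" and "m \<le> n" and "0 < \<delta>" and "\<alpha> < 1"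
    and small: "\<And>k. m \<le> k \<Longrightarrow> k \<le> n \<Longrightarrow>
      V {\<omega> \<in> space M. \<delta> \<le> \<bar>psum n \<omega> - psum k \<omega>\<bar>} \<le> ereal \<alpha>"
  shows "ereal (1 - \<alpha>) * V {\<omega> \<in> space M. \<exists>k\<in>{m..n}. 6 * \<delta> \<le> \<bar>psum k \<omega> - psum m \<omega>\<bar>}
    \<le> V {\<omega> \<in> space M. \<delta> \<le> \<bar>psum n \<omega> - psum m \<omega>\<bar>}" (is "_ * V ?Max \<le> V ?End")
proof -
  \<comment> \<open>\<open>f k\<close> is the smoothed indicator that \<open>k\<close> is the first exit time: \<open>Z k\<close> says that the walk is far
    from \<open>S\<^sub>m\<close> at time \<open>k\<close>, \<open>P k\<close> that it was never far before.\<close>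
  define Z where "Z k z = ramp (3 * \<delta>) (\<Sum>j=m..<k. z j)" for k z
  define P where "P k z = (\<Prod>i=m..<k. 1 - Z i z)" for k z
  define f where "f k z = Z k z * P k z" for k z
  define past where "past \<omega> = (\<lambda>j. X (j + 1) \<omega>)" for \<omega>
  define far where "far k \<omega> = ramp \<delta> (\<Sum>j=k..<n. X (j + 1) \<omega>)" for k \<omega>
  define escape where "escape \<omega> = (\<Sum>k=m..n. f k (past \<omega>))" for \<omega>
  define stay where "stay \<omega> = (\<Sum>k=m..n. f k (past \<omega>) * (1 - far k \<omega>))" for \<omega>
  define excess where "excess k \<omega> = f k (past \<omega>) * (far k \<omega> - \<alpha>)" for k \<omega>

  have Z01: "0 \<le> Z k z" "Z k z \<le> 1" for k z
    by (auto simp: Z_def ramp_nonneg ramp_le_1)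
  have P0: "0 \<le> P k z" for k z
    unfolding P_def using Z01 by (intro prod_nonneg) auto
  have f0: "0 \<le> f k z" for k z
    unfolding f_def using Z01 P0 by simp
  have telescope: "(\<Sum>k=m..n. f k z) = 1 - P (Suc n) z" for z
    using \<open>m \<le> n\<close>
  proof (induction n rule: dec_induct)
    case base
    show ?case by (simp add: f_def P_def)
  next
    case (step n)
    thus ?case by (simp add: f_def P_def algebra_simps)
  qed
  have f_sum_le: "(\<Sum>k=m..n. f k z) \<le> 1" for z
    unfolding telescope using P0[of "Suc n" z] by simp

  have Z_Lip: "Z i \<in> C_b_Lip k" if "i \<le> k" for i k
    unfolding Z_def[abs_def] using \<open>0 < \<delta>\<close> that
    by (intro C_b_Lip_block_sum bounded_lipschitz_ramp) auto
  have f_Lip: "f k \<in> C_b_Lip k" for k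
    unfolding f_def[abs_def] P_def[abs_def]
    by (intro C_b_Lip_mult C_b_Lip_prod C_b_Lip_diff C_b_Lip_const Z_Lip) auto
  have far_Lip: "bounded_lipschitz (\<lambda>x. ramp \<delta> x - c)" for c
    using bounded_lipschitz_diff_const bounded_lipschitz_ramp \<open>0 < \<delta>\<close> by blast
  have weighted: "(\<lambda>\<omega>. f k (past \<omega>) * (far k \<omega> - c)) \<in> bounded_H" if "k \<le> n" for k c
    using C_b_Lip_past_bounded_H[OF C_b_Lip_mult[OF C_b_Lip_mono[OF f_Lip that]
        C_b_Lip_block_sum[OF far_Lip order_refl]]]
    by (simp add: past_def far_def)
  have escape: "escape \<in> bounded_H"
    unfolding escape_def[abs_def] past_def
    by (intro bounded_H_sum C_b_Lip_past_bounded_H[OF f_Lip]) auto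
  have excess: "excess k \<in> bounded_H" if "k \<in> {m..n}" for k
    using weighted that by (simp add: excess_def[abs_def])
  have stay: "stay \<in> bounded_H"
  proof -
    have "(\<lambda>\<omega>. - 1 * (f k (past \<omega>) * (far k \<omega> - 1))) \<in> bounded_H" if "k \<le> n" for k
      by (intro bounded_H_scale weighted that)
    hence "(\<lambda>\<omega>. f k (past \<omega>) * (1 - far k \<omega>)) \<in> bounded_H" if "k \<le> n" for k
      using that by (simp add: algebra_simps)
    thus ?thesis unfolding stay_def[abs_def] by (intro bounded_H_sum) auto
  qed

  \<comment> \<open>On the maximal event some \<open>Z k\<close> equals \<open>1\<close>, which annihilates \<open>P\<close> and makes the weights sum to \<open>1\<close>.\<close>
  have "V ?Max \<le> E escape"
  proof (rule V_le_E[OF bounded_H_in_H[OF escape]])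
    fix \<omega> assume "\<omega> \<in> space M"
    show "indicator ?Max \<omega> \<le> escape \<omega>"
    proof (cases "\<omega> \<in> ?Max")
      case True
      then obtain k where k: "k \<in> {m..n}" "6 * \<delta> \<le> \<bar>psum k \<omega> - psum m \<omega>\<bar>" by auto
      hence "Z k (past \<omega>) = 1"
        using psum_diff[of m k \<omega>] \<open>0 < \<delta>\<close> by (auto simp: Z_def past_def intro!: ramp_eq_1)
      hence "P (Suc n) (past \<omega>) = 0"
        using k unfolding P_def by (intro prod_zero) (auto intro!: bexI[of _ k])
      thus ?thesis by (simp add: escape_def telescope)
    next
      case False
      thus ?thesis using f0 by (simp add: escape_def sum_nonneg)
    qed
  qed
  hence "ereal (1 - \<alpha>) * V ?Max \<le> ereal (1 - \<alpha>) * E escape"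
    using \<open>\<alpha> < 1\<close> by (intro ereal_mult_left_mono) auto
  also have "\<dots> = E (\<lambda>\<omega>. (1 - \<alpha>) * escape \<omega>)"
    using \<open>\<alpha> < 1\<close> by (simp add: scale bounded_H_in_H[OF escape])
  also have "(\<lambda>\<omega>. (1 - \<alpha>) * escape \<omega>) = (\<lambda>\<omega>. stay \<omega> + (\<Sum>k=m..n. excess k \<omega>))"
    unfolding stay_def escape_def excess_def
    by (simp add: sum_distrib_left algebra_simps flip: sum.distrib)
  also have "E \<dots> \<le> E stay + E (\<lambda>\<omega>. \<Sum>k=m..n. excess k \<omega>)"
    by (intro E_add_le stay bounded_H_sum excess) auto
  also have "\<dots> \<le> V ?End + 0"
  proof (rule add_mono)
    \<comment> \<open>If \<open>S\<^sub>n\<close> is within \<open>\<delta>\<close> of \<open>S\<^sub>m\<close>, then for each \<open>k\<close> either \<open>S\<^sub>n\<close> is \<open>2 * \<delta>\<close> away from \<open>S\<^sub>k\<close>, or \<open>S\<^sub>k\<close> is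
      too close to \<open>S\<^sub>m\<close> to count as an exit.\<close>
    show "E stay \<le> V ?End"
    proof (rule E_le_V[OF bounded_H_in_H[OF stay]])
      fix \<omega> assume \<omega>: "\<omega> \<in> space M"
      have le: "f k (past \<omega>) * (1 - far k \<omega>) \<le> f k (past \<omega>)" for k
        using f0[of k "past \<omega>"] ramp_nonneg[of \<delta>]
        by (simp add: far_def mult_left_le)
      show "stay \<omega> \<le> indicator ?End \<omega>"
      proof (cases "\<omega> \<in> ?End")
        case True
        have "stay \<omega> \<le> (\<Sum>k=m..n. f k (past \<omega>))"
          unfolding stay_def by (intro sum_mono le)
        also have "\<dots> \<le> 1" by (rule f_sum_le)
        finally show ?thesis using True by simp
      next
        case False
        have "f k (past \<omega>) * (1 - far k \<omega>) = 0" if k: "k \<in> {m..n}" for k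
        proof (cases "2 * \<delta> \<le> \<bar>psum n \<omega> - psum k \<omega>\<bar>")
          case True
          hence "far k \<omega> = 1"
            using psum_diff[of k n \<omega>] k \<open>0 < \<delta>\<close> by (auto simp: far_def intro!: ramp_eq_1)
          thus ?thesis by simp
        next
          case small: False
          have "\<bar>psum n \<omega> - psum m \<omega>\<bar> < \<delta>" using False \<omega> by auto
          with small have "\<bar>psum k \<omega> - psum m \<omega>\<bar> \<le> 3 * \<delta>" by linarith
          hence "Z k (past \<omega>) = 0"
            using psum_diff[of m k \<omega>] k \<open>0 < \<delta>\<close> by (auto simp: Z_def past_def intro!: ramp_eq_0)
          thus ?thesis by (simp add: f_def)
        qed
        hence "stay \<omega> = 0" unfolding stay_def by (intro sum.neutral ballI)
        thus ?thesis by simp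
      qed
    qed
    have "E (\<lambda>\<omega>. \<Sum>k=m..n. excess k \<omega>) \<le> (\<Sum>k=m..n. E (excess k))"
      by (intro E_sum_le excess) auto
    also have "\<dots> \<le> (\<Sum>k=m..n. 0)"
    proof (rule sum_mono)
      fix k assume k: "k \<in> {m..n}"
      have far: "far k \<in> bounded_H"
        using C_b_Lip_past_bounded_H[OF C_b_Lip_block_sum[OF
            bounded_lipschitz_ramp[OF \<open>0 < \<delta>\<close>] order_refl]]
        by (simp add: far_def[abs_def])
      have "E (far k) \<le> V {\<omega> \<in> space M. \<delta> \<le> \<bar>psum n \<omega> - psum k \<omega>\<bar>}"
      proof (rule E_le_V[OF bounded_H_in_H[OF far]])
        fix \<omega> assume "\<omega> \<in> space M"
        thus "far k \<omega> \<le> indicator {\<omega> \<in> space M. \<delta> \<le> \<bar>psum n \<omega> - psum k \<omega>\<bar>} \<omega>"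
          using k psum_diff[of k n \<omega>] ramp_le_1 ramp_eq_0[OF \<open>0 < \<delta>\<close>]
          by (auto simp: far_def indicator_def)
      qed
      also have "\<dots> \<le> ereal \<alpha>" using small k by simp
      finally have "E (far k) + ereal (- \<alpha>) \<le> 0"
        by (cases "E (far k)") auto
      hence neg: "E (\<lambda>\<omega>. far k \<omega> - \<alpha>) \<le> 0"
        using E_add_const[OF far, of "- \<alpha>"] by simp
      have "E (excess k) = E (\<lambda>\<omega>. f k (past \<omega>) * real_of_ereal (E (\<lambda>\<omega>. far k \<omega> - \<alpha>)))"
        using E_past_times_future[OF _ _ f_Lip f0 far_Lip[of \<alpha>], of k n] k \<open>1 \<le> m\<close>
        by (simp add: excess_def[abs_def] past_def far_def)
      also have "\<dots> \<le> E (\<lambda>_. 0)"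
      proof (rule mono)
        have "(\<lambda>\<omega>. real_of_ereal (E (\<lambda>\<omega>. far k \<omega> - \<alpha>)) * f k (past \<omega>)) \<in> bounded_H"
          unfolding past_def by (intro bounded_H_scale C_b_Lip_past_bounded_H[OF f_Lip])
        thus "(\<lambda>\<omega>. f k (past \<omega>) * real_of_ereal (E (\<lambda>\<omega>. far k \<omega> - \<alpha>))) \<in> H"
          by (simp add: bounded_H_in_H mult.commute)
        have "real_of_ereal (E (\<lambda>\<omega>. far k \<omega> - \<alpha>)) \<le> 0"
          using neg by (cases "E (\<lambda>\<omega>. far k \<omega> - \<alpha>)") auto
        thus "f k (past \<omega>) * real_of_ereal (E (\<lambda>\<omega>. far k \<omega> - \<alpha>)) \<le> 0" for \<omega>
          using f0 by (simp add: mult_nonneg_nonpos)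
      qed (rule const_in_H)
      finally show "E (excess k) \<le> 0" by (simp add: const zero_ereal_def)
    qed
    finally show "E (\<lambda>\<omega>. \<Sum>k=m..n. excess k \<omega>) \<le> 0" by simp
  qed
  finally show ?thesis by simp
qed


section \<open>From convergence in capacity to quasi-sure convergence\<close>

text \<open>
  Since \<open>S\<close> need not belong to \<open>H\<close>, it enters only through the events \<open>\<bar>S\<^sub>n - S\<bar> \<ge> \<epsilon>\<close>: these bound the
  increments \<open>S\<^sub>n - S\<^sub>k\<close> for the maximal inequality with \<open>\<alpha> = 1 / 2\<close>, and afterwards the distance from
  \<open>S\<^sub>m\<close> to \<open>S\<close>. The index \<open>N\<close> is the same for all blocks beyond it.
\<close>

lemma block_deviation:
  assumes csub: "countably_subadditive_capacity M V" and [measurable]: "S \<in> borel_measurable M"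
    and lim: "\<And>\<epsilon>. 0 < \<epsilon> \<Longrightarrow> (\<lambda>n. V {\<omega> \<in> space M. \<epsilon> \<le> \<bar>psum n \<omega> - S \<omega>\<bar>}) \<longlonglongrightarrow> 0"
    and "0 < \<delta>" and "\<delta> \<le> 1"
  shows "\<exists>N. \<forall>m n. N \<le> m \<longrightarrow> m \<le> n \<longrightarrow>
    V {\<omega> \<in> space M. \<exists>k\<in>{m..n}. 7 * \<delta> \<le> \<bar>psum k \<omega> - S \<omega>\<bar>} \<le> ereal (2 * \<delta>)"
proof -
  let ?D = "\<lambda>n \<epsilon>. {\<omega> \<in> space M. \<epsilon> \<le> \<bar>psum n \<omega> - S \<omega>\<bar>}"
  have "eventually (\<lambda>n. V (?D n (\<delta> / 2)) < ereal (\<delta> / 4)) sequentially"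
    using lim[of "\<delta> / 2"] \<open>0 < \<delta>\<close> by (intro order_tendstoD) auto
  then obtain N where N: "\<And>n. N \<le> n \<Longrightarrow> V (?D n (\<delta> / 2)) < ereal (\<delta> / 4)"
    unfolding eventually_sequentially by blast
  have pair: "V {\<omega> \<in> space M. \<delta> \<le> \<bar>psum n \<omega> - psum k \<omega>\<bar>} \<le> ereal (\<delta> / 2)"
    if "N \<le> k" "N \<le> n" for k n
  proof -
    have "V {\<omega> \<in> space M. \<delta> \<le> \<bar>psum n \<omega> - psum k \<omega>\<bar>} \<le> V (?D n (\<delta> / 2) \<union> ?D k (\<delta> / 2))"
    proof (rule V_mono, safe)
      fix \<omega> assume "\<delta> \<le> \<bar>psum n \<omega> - psum k \<omega>\<bar>" "\<not> \<delta> / 2 \<le> \<bar>psum k \<omega> - S \<omega>\<bar>"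
      thus "\<delta> / 2 \<le> \<bar>psum n \<omega> - S \<omega>\<bar>" by linarith
    qed
    also have "\<dots> \<le> V (?D n (\<delta> / 2)) + V (?D k (\<delta> / 2))"
      by (intro V_Un_le[OF csub]) measurable
    also have "\<dots> \<le> ereal (\<delta> / 4) + ereal (\<delta> / 4)"
      using N[OF that(1)] N[OF that(2)] by (intro add_mono) auto
    finally show ?thesis by simp
  qed
  have "V {\<omega> \<in> space M. \<exists>k\<in>{m..n}. 7 * \<delta> \<le> \<bar>psum k \<omega> - S \<omega>\<bar>} \<le> ereal (2 * \<delta>)"
    if m: "max 1 N \<le> m" and n: "m \<le> n" for m n
  proof -
    let ?Max = "{\<omega> \<in> space M. \<exists>k\<in>{m..n}. 6 * \<delta> \<le> \<bar>psum k \<omega> - psum m \<omega>\<bar>}"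
    have "ereal (1 - 1 / 2) * V ?Max \<le> V {\<omega> \<in> space M. \<delta> \<le> \<bar>psum n \<omega> - psum m \<omega>\<bar>}"
    proof (rule maximal_inequality)
      fix k assume "m \<le> k" "k \<le> n"
      hence "V {\<omega> \<in> space M. \<delta> \<le> \<bar>psum n \<omega> - psum k \<omega>\<bar>} \<le> ereal (\<delta> / 2)"
        using m by (intro pair) auto
      also have "\<dots> \<le> ereal (1 / 2)" using \<open>\<delta> \<le> 1\<close> by simp
      finally show "V {\<omega> \<in> space M. \<delta> \<le> \<bar>psum n \<omega> - psum k \<omega>\<bar>} \<le> ereal (1 / 2)" .
    qed (use m n \<open>0 < \<delta>\<close> in auto)
    also have "\<dots> \<le> ereal (\<delta> / 2)" using m n by (intro pair) auto
    finally have Max: "V ?Max \<le> ereal \<delta>"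
      by (cases "V ?Max") auto
    have "V {\<omega> \<in> space M. \<exists>k\<in>{m..n}. 7 * \<delta> \<le> \<bar>psum k \<omega> - S \<omega>\<bar>} \<le> V (?Max \<union> ?D m (\<delta> / 2))"
    proof (rule V_mono, safe)
      fix \<omega> k assume "\<omega> \<in> space M" "k \<in> {m..n}" "7 * \<delta> \<le> \<bar>psum k \<omega> - S \<omega>\<bar>"
        and D: "\<not> \<delta> / 2 \<le> \<bar>psum m \<omega> - S \<omega>\<bar>"
      thus "\<exists>k\<in>{m..n}. 6 * \<delta> \<le> \<bar>psum k \<omega> - psum m \<omega>\<bar>"
        using \<open>0 < \<delta>\<close> by (intro bexI[of _ k]) linarith+
    qed
    also have "\<dots> \<le> V ?Max + V (?D m (\<delta> / 2))"
      by (intro V_Un_le[OF csub]) measurable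
    also have "\<dots> \<le> ereal \<delta> + ereal (\<delta> / 4)"
      using N[of m] m Max by (intro add_mono) auto
    also have "\<dots> \<le> ereal (2 * \<delta>)" using \<open>0 < \<delta>\<close> by simp
    finally show ?thesis .
  qed
  thus ?thesis by blast
qed

lemma converges_quasi_surely:
  assumes csub: "countably_subadditive_capacity M V" and [measurable]: "S \<in> borel_measurable M"
    and lim: "\<And>\<epsilon>. 0 < \<epsilon> \<Longrightarrow> (\<lambda>n. V {\<omega> \<in> space M. \<epsilon> \<le> \<bar>psum n \<omega> - S \<omega>\<bar>}) \<longlonglongrightarrow> 0"
  shows "V {\<omega> \<in> space M. \<not> (\<lambda>n. psum n \<omega>) \<longlonglongrightarrow> S \<omega>} = 0" (is "V ?N = 0")
proof -
  define \<delta> :: "nat \<Rightarrow> real" where "\<delta> j = (1 / 2) ^ j" for j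
  have \<delta>: "0 < \<delta> j" "\<delta> j \<le> 1" for j
    by (auto simp: \<delta>_def power_le_one)
  have "\<forall>j. \<exists>N. \<forall>m n. N \<le> m \<longrightarrow> m \<le> n \<longrightarrow>
      V {\<omega> \<in> space M. \<exists>k\<in>{m..n}. 7 * \<delta> j \<le> \<bar>psum k \<omega> - S \<omega>\<bar>} \<le> ereal (2 * \<delta> j)"
    using block_deviation[OF csub _ lim] \<delta> by simp
  from choice[OF this] obtain N where N: "V {\<omega> \<in> space M. \<exists>k\<in>{m..n}. 7 * \<delta> j \<le> \<bar>psum k \<omega> - S \<omega>\<bar>}
      \<le> ereal (2 * \<delta> j)" if "N j \<le> m" "m \<le> n" for j m n
    by blast
  \<comment> \<open>The blocks are \<open>r j, \<dots>, r (Suc j)\<close>. Summing instead of taking a maximum makes \<open>r\<close> strictly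
    increasing, so the blocks cover all large indices.\<close>
  define r where "r j = (\<Sum>i\<le>j. N i + 1)" for j
  have r: "N j \<le> r j" "r j \<le> r (Suc j)" "j \<le> r j" for j
  proof -
    have "N j + 1 \<le> r j" unfolding r_def by (rule member_le_sum) auto
    thus "N j \<le> r j" by simp
    show "r j \<le> r (Suc j)" by (simp add: r_def)
    have "(\<Sum>i\<le>j. 1) \<le> r j" unfolding r_def by (rule sum_mono) simp
    thus "j \<le> r j" by simp
  qed
  define D where "D j = {\<omega> \<in> space M. \<exists>k\<in>{r j..r (Suc j)}. 7 * \<delta> j \<le> \<bar>psum k \<omega> - S \<omega>\<bar>}" for j
  have [measurable]: "D j \<in> sets M" for j
    unfolding D_def by measurable
  have D: "V (D j) \<le> ereal (2 * \<delta> j)" for j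
    unfolding D_def by (rule N[OF r(1,2)])
  have cover: "?N \<subseteq> (\<Union>j. D (j + J))" for J
  proof (rule subsetI, rule ccontr)
    fix \<omega> assume \<omega>: "\<omega> \<in> ?N" and "\<omega> \<notin> (\<Union>j. D (j + J))"
    hence out: "\<omega> \<notin> D j" if "J \<le> j" for j
      using that by (metis UN_I UNIV_I le_add_diff_inverse2)
    have "(\<lambda>n. psum n \<omega>) \<longlonglongrightarrow> S \<omega>"
    proof (rule LIMSEQ_I)
      fix e :: real assume "0 < e"
      have "(\<lambda>j. 7 * \<delta> j) \<longlonglongrightarrow> 7 * 0"
        unfolding \<delta>_def by (intro tendsto_intros LIMSEQ_power_zero) auto
      hence "eventually (\<lambda>j. 7 * \<delta> j < e) sequentially"
        using \<open>0 < e\<close> by (intro order_tendstoD) auto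
      then obtain J' where J': "\<And>j. J' \<le> j \<Longrightarrow> 7 * \<delta> j < e"
        unfolding eventually_sequentially by blast
      define J0 where "J0 = max J J'"
      have "norm (psum n \<omega> - S \<omega>) < e" if n: "r J0 \<le> n" for n
      proof -
        \<comment> \<open>The first block end beyond \<open>n\<close> locates the block containing \<open>n\<close>.\<close>
        define i where "i = (LEAST i. n < r (J0 + i))"
        have "n < r (J0 + Suc n)" using r(3)[of "J0 + Suc n"] by simp
        hence i: "n < r (J0 + i)" unfolding i_def by (rule LeastI)
        hence "i \<noteq> 0" using n by (intro notI) simp
        then obtain i' where i': "i = Suc i'" by (cases i) auto
        have "\<not> n < r (J0 + i')"
          using not_less_Least[of i' "\<lambda>i. n < r (J0 + i)"] i' unfolding i_def by simp
        with i i' have "n \<in> {r (J0 + i')..r (Suc (J0 + i'))}" by simp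
        moreover have "\<omega> \<notin> D (J0 + i')" by (rule out) (simp add: J0_def)
        ultimately have "\<bar>psum n \<omega> - S \<omega>\<bar> < 7 * \<delta> (J0 + i')"
          using \<omega> unfolding D_def by force
        also have "\<dots> < e" by (rule J') (simp add: J0_def)
        finally show ?thesis by simp
      qed
      thus "\<exists>no. \<forall>n\<ge>no. norm (psum n \<omega> - S \<omega>) < e" by blast
    qed
    thus False using \<omega> by simp
  qed
  have bound: "V ?N \<le> ereal (4 * \<delta> J)" for J
  proof -
    have "V ?N \<le> V (\<Union>j. D (j + J))" by (rule V_mono[OF cover])
    also have "\<dots> \<le> (\<Sum>j. V (D (j + J)))"
      by (rule csub[unfolded countably_subadditive_capacity_def, rule_format]) auto
    also have "\<dots> \<le> (\<Sum>j. ereal (2 * \<delta> (j + J)))"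
      by (intro suminf_le_pos D V_nonneg)
    also have "\<dots> = ereal (4 * \<delta> J)"
    proof (rule sums_unique[symmetric])
      have "(\<lambda>j. 2 * \<delta> J * (1 / 2) ^ j) sums (2 * \<delta> J * (1 / (1 - 1 / 2)))"
        by (intro sums_mult geometric_sums) simp
      thus "(\<lambda>j. ereal (2 * \<delta> (j + J))) sums ereal (4 * \<delta> J)"
        unfolding sums_ereal by (simp add: \<delta>_def power_add mult_ac)
    qed
    finally show ?thesis .
  qed
  have "(\<lambda>J. ereal (4 * \<delta> J)) \<longlonglongrightarrow> ereal (4 * 0)"
    unfolding \<delta>_def by (intro tendsto_intros LIMSEQ_power_zero) auto
  hence "V ?N \<le> ereal (4 * 0)"
    by (rule LIMSEQ_le_const) (use bound in auto)
  thus ?thesis using V_nonneg[of ?N] by (simp add: zero_ereal_def)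
qed

end


section \<open>From quasi-sure convergence to convergence in capacity\<close>

lemma (in sublinear_expectation_space) converges_in_capacity:
  fixes Y :: "nat \<Rightarrow> 'a \<Rightarrow> real"
  assumes cont: "continuous_capacity M V"
    and [measurable]: "\<And>n. Y n \<in> borel_measurable M" "S \<in> borel_measurable M"
    and null: "V {\<omega> \<in> space M. \<not> (\<lambda>n. Y n \<omega>) \<longlonglongrightarrow> S \<omega>} = 0" and "0 < \<epsilon>"
  shows "(\<lambda>n. V {\<omega> \<in> space M. \<epsilon> \<le> \<bar>Y n \<omega> - S \<omega>\<bar>}) \<longlonglongrightarrow> 0"
proof -
  define D where "D n = (\<Union>k\<in>{n..}. {\<omega> \<in> space M. \<epsilon> \<le> \<bar>Y k \<omega> - S \<omega>\<bar>})" for n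
  have "D n \<in> sets M" for n
    unfolding D_def by measurable
  moreover have "D n \<subseteq> D m" if "m \<le> n" for m n
    unfolding D_def using that by (intro UN_mono) auto
  hence "decseq D" by (intro antimonoI)
  ultimately have "(\<lambda>n. V (D n)) \<longlonglongrightarrow> V (\<Inter>n. D n)"
    by (intro conjunct2[OF cont[unfolded continuous_capacity_def], rule_format]) auto
  moreover have "V (\<Inter>n. D n) \<le> 0"
    unfolding null[symmetric]
  proof (rule V_mono, safe)
    fix \<omega> assume \<omega>: "\<omega> \<in> (\<Inter>n. D n)"
    thus "\<omega> \<in> space M" by (auto simp: D_def)
    assume "(\<lambda>n. Y n \<omega>) \<longlonglongrightarrow> S \<omega>"
    from LIMSEQ_D[OF this \<open>0 < \<epsilon>\<close>] obtain n where "\<And>k. n \<le> k \<Longrightarrow> \<bar>Y k \<omega> - S \<omega>\<bar> < \<epsilon>"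
      by auto
    moreover have "\<omega> \<in> D n" using \<omega> by blast
    ultimately show False by (force simp: D_def)
  qed
  hence "V (\<Inter>n. D n) = 0"
    using V_nonneg by (rule antisym)
  ultimately have D: "(\<lambda>n. V (D n)) \<longlonglongrightarrow> 0"
    by (simp only:)
  have le: "V {\<omega> \<in> space M. \<epsilon> \<le> \<bar>Y n \<omega> - S \<omega>\<bar>} \<le> V (D n)" for n
    unfolding D_def by (intro V_mono) auto
  show ?thesis
    by (rule tendsto_sandwich[OF _ _ tendsto_const D]) (intro always_eventually allI V_nonneg le)+
qed

theorem theorem3p1:
  fixes M :: "'a measure"
    and H :: "('a \<Rightarrow> real) set"
    and E :: "('a \<Rightarrow> real) \<Rightarrow> ereal"
    and X :: "nat \<Rightarrow> 'a \<Rightarrow> real"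
    and S :: "'a \<Rightarrow> real"
    and V :: "'a set \<Rightarrow> ereal"
    and Sn :: "nat \<Rightarrow> 'a \<Rightarrow> real"
    and A B :: bool
  assumes "sublinear_expectation_space M H E"
    and "independent_seq H E X"
    and "S \<in> borel_measurable M"
  defines "V \<equiv> upper_capacity M H E"
    and "Sn \<equiv> (\<lambda>n \<omega>. \<Sum>k=1..n. X k \<omega>)"
    and "A \<equiv> (\<forall>\<epsilon>::real. \<epsilon> > 0 \<longrightarrow> (\<lambda>n. V {\<omega> \<in> space M. \<bar>Sn n \<omega> - S \<omega>\<bar> \<ge> \<epsilon>}) \<longlonglongrightarrow> 0)"
    and "B \<equiv> V {\<omega> \<in> space M. \<not> (\<lambda>n. Sn n \<omega>) \<longlonglongrightarrow> S \<omega>} = 0"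
  shows "(countably_subadditive_capacity M V \<longrightarrow> A \<longrightarrow> B) \<and>
         (continuous_capacity M V \<longrightarrow> B \<longrightarrow> A)"
proof -
  interpret independent_sequence M H E X
    using assms(1,2) by (simp add: independent_sequence_def independent_sequence_axioms_def)
  have Sn: "Sn = psum" by (simp add: Sn_def psum_def fun_eq_iff)
  show ?thesis
    unfolding A_def B_def Sn V_def
  proof (intro conjI impI allI)
    assume "countably_subadditive_capacity M (upper_capacity M H E)"
      and "\<forall>\<epsilon>>0. (\<lambda>n. upper_capacity M H E {\<omega> \<in> space M. \<epsilon> \<le> \<bar>psum n \<omega> - S \<omega>\<bar>}) \<longlonglongrightarrow> 0"
    thus "upper_capacity M H E {\<omega> \<in> space M. \<not> (\<lambda>n. psum n \<omega>) \<longlonglongrightarrow> S \<omega>} = 0"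
      by (intro converges_quasi_surely assms(3)) simp_all
  qed (rule converges_in_capacity[OF _ psum_measurable assms(3)])
qed

end
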